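(* Let $1 \leq p < \infty$, let $\mathcal{B}_0,\mathcal{B}_1$ be Banach spaces over the same field $\mathbb{F}\in\{\mathbb{R},\mathbb{C}\}$, and for each $j \in \{0,1\}$ let $\phi_j : S_j \to \mathcal{B}_j$ be an $L^p$-formal disintegration of $\mathcal{B}_j$, where $S_j \subseteq \mathbb{N}^*$ is a tree. Suppose $f$ is an isomorphism of $\phi_0$ with $\phi_1$. Then there is a unique isometric isomorphism $T_f$ of $\mathcal{B}_0$ onto $\mathcal{B}_1$ such that $T_f(\phi_0(\nu)) = \phi_1(f(\nu))$ for all $\nu \in S_0$.
   Context: $\mathbb{N}$ is the set of nonnegative integers and $\mathbb{N}^*$ the set of all finite sequences of elements of $\mathbb{N}$ (including the empty sequence). For $\sigma,\tau\in\mathbb{N}^*$, $\sigma \sqsubseteq \tau$ means $\sigma$ is a prefix of $\tau$; $\tau$ is a child of $\sigma$ if $\sigma \sqsubseteq\tau$ and $|\tau| = |\sigma|+1$. A tree is a nonempty subset of $\mathbb{N}^*$ closed under prefixes. For a Banach space $\mathcal{B}$, vectors $v_1,\dots,v_n \in \mathcal{B}$ are $L^p$-formally disjointly supported if $\|\sum_j \alpha_j v_j\|^p = \sum_j |\alpha_j|^p \|v_j\|^p$ for all scalars $\alpha_1,\dots,\alpha_n$. For a tree $S$ and a map $\phi: S\to\mathcal{B}$: $\phi$ is summative if for every $\nu\in S$, $\phi(\nu) = \sum_{\nu'}\phi(\nu')$ where $\nu'$ ranges over the children of $\nu$ in $S$; $\phi$ is formally $L^p$-separating if $\phi(\nu_1),\dots,\phi(\nu_n)$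 are $L^p$-formally disjointly supported whenever $\nu_1,\dots,\nu_n\in S$ are pairwise $\sqsubseteq$-incomparable; $\phi$ is an $L^p$-formal disintegration of $\mathcal{B}$ if it is summative, formally $L^p$-separating, never takes the value $0$, and the linear span of its range is dense in $\mathcal{B}$. If $\phi_j : S_j\to\mathcal{B}_j$ ($j=0,1$), an isomorphism of $\phi_0$ and $\phi_1$ is a map $f : S_0\to S_1$ which is an order isomorphism (with respect to $\sqsubseteq$) of $S_0$ onto $S_1$ and satisfies $\|\phi_1(f(\nu))\|_{\mathcal{B}_1} = \|\phi_0(\nu)\|_{\mathcal{B}_0}$ for all $\nu\in S_0$. *)

theory Defs
  imports "HOL-Analysis.Analysis" "HOL-Library.Sublist"
begin

text \<open>Scalar fields: the normed fields isometrically isomorphic to the real or to the complex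
  numbers.\<close>

class real_or_complex = real_normed_field +
  assumes real_or_complex:
    "(\<exists>h :: 'a \<Rightarrow> real. bij h \<and> (\<forall>x y. h (x + y) = h x + h y) \<and>
        (\<forall>x y. h (x * y) = h x * h y) \<and> (\<forall>x. norm (h x) = norm x)) \<or>
     (\<exists>h :: 'a \<Rightarrow> complex. bij h \<and> (\<forall>x y. h (x + y) = h x + h y) \<and>
        (\<forall>x y. h (x * y) = h x * h y) \<and> (\<forall>x. norm (h x) = norm x))"

instance real :: real_or_complex
  by standard (intro disjI1 exI[of _ id], simp)

instance complex :: real_or_complex
  by standard (intro disjI2 exI[of _ id], simp)

text \<open>The class \<open>banach\<close> only provides a real scalar multiplication, so the
  multiplication by scalars of the field is an explicit parameter extending it.\<close>

locale banach_over = vector_space smul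
  for smul :: "'k::real_or_complex \<Rightarrow> 'b::banach \<Rightarrow> 'b" +
  assumes smul_of_real: "smul (of_real r) x = r *\<^sub>R x"
    and norm_smul: "norm (smul c x) = norm c * norm x"

lemma banach_over_real: "banach_over (scaleR :: real \<Rightarrow> 'b::banach \<Rightarrow> 'b)"
  by unfold_locales (auto simp: algebra_simps)

lemma banach_over_complex: "banach_over ((*) :: complex \<Rightarrow> complex \<Rightarrow> complex)"
  by unfold_locales (auto simp: algebra_simps norm_mult scaleR_conv_of_real)

definition is_tree :: "nat list set \<Rightarrow> bool" where
  "is_tree S \<longleftrightarrow> S \<noteq> {} \<and> (\<forall>\<tau>\<in>S. \<forall>\<sigma>. prefix \<sigma> \<tau> \<longrightarrow> \<sigma> \<in> S)"

definition children :: "nat list set \<Rightarrow> nat list \<Rightarrow> nat list set" where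
  "children S \<nu> = {\<tau> \<in> S. prefix \<nu> \<tau> \<and> length \<tau> = length \<nu> + 1}"

text \<open>The vectors are \<open>v 0, \<dots>, v (n - 1)\<close>.\<close>

definition formally_disjointly_supported ::
    "real \<Rightarrow> ('k::real_or_complex \<Rightarrow> 'b::banach \<Rightarrow> 'b) \<Rightarrow> nat \<Rightarrow> (nat \<Rightarrow> 'b) \<Rightarrow> bool" where
  "formally_disjointly_supported p smul n v \<longleftrightarrow>
     (\<forall>\<alpha> :: nat \<Rightarrow> 'k. norm (\<Sum>j<n. smul (\<alpha> j) (v j)) powr p =
        (\<Sum>j<n. norm (\<alpha> j) powr p * norm (v j) powr p))"

text \<open>A node may have infinitely many children; the sum is then unordered (unconditional)
  convergence in norm. At a node without children the sum is \<open>0\<close>.\<close>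

definition summative :: "nat list set \<Rightarrow> (nat list \<Rightarrow> 'b::banach) \<Rightarrow> bool" where
  "summative S \<phi> \<longleftrightarrow> (\<forall>\<nu>\<in>S. (\<phi> has_sum \<phi> \<nu>) (children S \<nu>))"

text \<open>Incomparability with respect to \<open>prefix\<close> is the library's \<open>parallel\<close>.\<close>

definition formally_separating ::
    "real \<Rightarrow> ('k::real_or_complex \<Rightarrow> 'b::banach \<Rightarrow> 'b) \<Rightarrow> nat list set \<Rightarrow>
      (nat list \<Rightarrow> 'b) \<Rightarrow> bool" where
  "formally_separating p smul S \<phi> \<longleftrightarrow>
     (\<forall>n (\<nu> :: nat \<Rightarrow> nat list).
        (\<forall>i<n. \<nu> i \<in> S) \<and> (\<forall>i<n. \<forall>j<n. i \<noteq> j \<longrightarrow> \<nu> i \<parallel> \<nu> j) \<longrightarrow>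
        formally_disjointly_supported p smul n (\<lambda>i. \<phi> (\<nu> i)))"

definition formal_disintegration ::
    "real \<Rightarrow> ('k::real_or_complex \<Rightarrow> 'b::banach \<Rightarrow> 'b) \<Rightarrow> nat list set \<Rightarrow>
      (nat list \<Rightarrow> 'b) \<Rightarrow> bool" where
  "formal_disintegration p smul S \<phi> \<longleftrightarrow>
     summative S \<phi> \<and> formally_separating p smul S \<phi> \<and> (\<forall>\<nu>\<in>S. \<phi> \<nu> \<noteq> 0) \<and>
     closure (module.span smul (\<phi> ` S)) = UNIV"

definition disintegration_iso ::
    "nat list set \<Rightarrow> (nat list \<Rightarrow> 'b0::banach) \<Rightarrow> nat list set \<Rightarrow> (nat list \<Rightarrow> 'b1::banach) \<Rightarrow>
      (nat list \<Rightarrow> nat list) \<Rightarrow> bool" where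
  "disintegration_iso S0 \<phi>0 S1 \<phi>1 f \<longleftrightarrow>
     bij_betw f S0 S1 \<and>
     (\<forall>\<mu>\<in>S0. \<forall>\<nu>\<in>S0. prefix (f \<mu>) (f \<nu>) \<longleftrightarrow> prefix \<mu> \<nu>) \<and>
     (\<forall>\<nu>\<in>S0. norm (\<phi>1 (f \<nu>)) = norm (\<phi>0 \<nu>))"

definition isometric_isomorphism ::
    "('k::real_or_complex \<Rightarrow> 'b0::banach \<Rightarrow> 'b0) \<Rightarrow> ('k \<Rightarrow> 'b1::banach \<Rightarrow> 'b1) \<Rightarrow>
      ('b0 \<Rightarrow> 'b1) \<Rightarrow> bool" where
  "isometric_isomorphism smul0 smul1 T \<longleftrightarrow>
     Vector_Spaces.linear smul0 smul1 T \<and> bij T \<and> (\<forall>x. norm (T x) = norm x)"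

end

theory Submission imports Defs begin

text \<open>Given a finite subtree \<open>F\<close> of \<open>S\<close>, summativity expands each \<open>\<phi> \<mu>\<close>, \<open>\<mu> \<in> F\<close>, into the sum of
  \<open>\<phi>\<close> over the minimal nodes outside \<open>F\<close> that extend \<open>\<mu>\<close>. These nodes are pairwise incomparable,
  so the separation property computes the norm of any linear combination of the \<open>\<phi> \<mu>\<close> from the
  norms of \<open>\<phi>\<close> at these nodes, the coefficients and the prefix order alone, all of which \<open>f\<close>
  preserves. The closure of the span of the pairs \<open>(\<phi>0 \<nu>, \<phi>1 (f \<nu>))\<close> in the product space is then
  the graph of the isometry.\<close>

section \<open>Expansion of a node over the boundary of a finite subtree\<close>

definition boundary :: "nat list set \<Rightarrow> nat list set \<Rightarrow> nat list set" where
  "boundary S F = {x \<in> S - F. \<forall>y\<in>S. strict_prefix y x \<longrightarrow> y \<in> F}"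

lemma boundary_parallel:
  assumes "x \<in> boundary S F" "y \<in> boundary S F" "x \<noteq> y"
  shows "x \<parallel> y"
  using assms by (auto simp: boundary_def strict_prefix_def)

lemma childrenE:
  assumes "z \<in> children S x"
  obtains a where "z = x @ [a]" "z \<in> S"
proof -
  obtain ys where "z = x @ ys" "length ys = 1" "z \<in> S"
    using assms by (auto simp: children_def prefix_def)
  then show ?thesis using that by (auto simp: length_Suc_conv)
qed

text \<open>Closedness makes \<open>x\<close> itself a boundary node of \<open>F\<close>, and
  maximality of its length does the rest. The parent of a new boundary node above \<open>x\<close>
  lies in \<open>insert x F\<close>, hence is no longer than \<open>x\<close>, so that node is a
  child of \<open>x\<close>. Conversely, the children of \<open>x\<close> are too long to lie in
  \<open>F\<close>.\<close>

lemma boundary_insert: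
  assumes S: "is_tree S" and FS: "insert x F \<subseteq> S" and xF: "x \<notin> F"
    and closed: "\<And>\<sigma> \<tau>. \<tau> \<in> insert x F \<Longrightarrow> prefix \<sigma> \<tau> \<Longrightarrow> \<sigma> \<in> insert x F"
    and le: "\<And>y. y \<in> F \<Longrightarrow> length y \<le> length x"
  shows "boundary S (insert x F) = (boundary S F - {x}) \<union> children S x"
proof (intro set_eqI iffI)
  fix z assume z: "z \<in> boundary S (insert x F)"
  show "z \<in> (boundary S F - {x}) \<union> children S x"
  proof (cases "strict_prefix x z")
    case True
    then have "z \<noteq> []" by auto
    then have bz: "strict_prefix (butlast z) z"
      by (metis append_butlast_last_id strict_prefixI')
    moreover have "z \<in> S" using z by (auto simp: boundary_def)
    ultimately have "butlast z \<in> S" using S unfolding is_tree_def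
      by (meson strict_prefix_def)
    with bz z have "butlast z \<in> insert x F" by (auto simp: boundary_def)
    then have "length z - 1 \<le> length x" using le by fastforce
    moreover have "length x < length z" using True by (rule prefix_length_less)
    ultimately have "length z = length x + 1" by linarith
    with True \<open>z \<in> S\<close> show ?thesis by (auto simp: children_def strict_prefix_def)
  next
    case False
    then show ?thesis using z by (auto simp: boundary_def)
  qed
next
  fix z assume z: "z \<in> (boundary S F - {x}) \<union> children S x"
  show "z \<in> boundary S (insert x F)"
  proof (cases "z \<in> children S x")
    case False
    then show ?thesis using z by (auto simp: boundary_def)
  next
    case True
    then obtain a where a: "z = x @ [a]" and zS: "z \<in> S"
      by (rule childrenE)
    have "z \<notin> insert x F" using le[of z] a by auto
    moreover have "y \<in> insert x F" if "strict_prefix y z" for y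
      using that closed[of x y] a by (auto simp: strict_prefix_def prefix_snoc)
    ultimately show ?thesis using zS by (auto simp: boundary_def)
  qed
qed

text \<open>Nodes are inserted in order of nondecreasing length. For \<mu> = \<open>x\<close> the
  claim is summativity at \<open>x\<close>. If \<mu> is a proper prefix of \<open>x\<close>, the
  single term at \<open>x\<close> is replaced by the sum over its children. For every other \<mu>
  the index set does not change.\<close>

lemma has_sum_boundary:
  fixes \<phi> :: "nat list \<Rightarrow> 'b::banach"
  assumes S: "is_tree S" and \<phi>: "summative S \<phi>"
    and "finite F" and "F \<subseteq> S"
    and "\<And>\<sigma> \<tau>. \<tau> \<in> F \<Longrightarrow> prefix \<sigma> \<tau> \<Longrightarrow> \<sigma> \<in> F"
    and "\<mu> \<in> F"
  shows "(\<phi> has_sum \<phi> \<mu>) {x \<in> boundary S F. prefix \<mu> x}"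
  using assms(3-)
proof (induction F arbitrary: \<mu> rule: finite_ranking_induct[where f = length])
  case empty
  then show ?case by simp
next
  case (insert x F)
  show ?case
  proof (cases "x \<in> F")
    \<comment> \<open>The ranking induction does not guarantee that the inserted node is
      new.\<close>
    case True
    then show ?thesis using insert by (simp add: insert_absorb)
  next
    case False
    have eq: "boundary S (insert x F) = (boundary S F - {x}) \<union> children S x"
      using S insert.prems(1) False insert.prems(2) insert.hyps(2)
      by (rule boundary_insert)
    have xS: "x \<in> S" using insert.prems by auto
    have ch: "(\<phi> has_sum \<phi> x) (children S x)"
      using \<phi> xS by (simp add: summative_def)
    \<comment> \<open>Removing \<open>x\<close> keeps the set closed under prefixes: no node of
      \<open>F\<close> is longer than \<open>x\<close>, so \<open>x\<close> could only be a prefix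
      of itself.\<close>
    have closed: "\<sigma> \<in> F" if "\<tau> \<in> F" "prefix \<sigma> \<tau>" for \<sigma> \<tau>
    proof -
      have "\<sigma> \<noteq> x"
      proof
        assume "\<sigma> = x"
        then have "\<sigma> = \<tau>" using insert.hyps(2)[OF that(1)] that(2)
          by (metis le_antisym not_equal_is_parallel parallel_def prefix_length_le)
        then show False using \<open>\<sigma> = x\<close> that(1) False by simp
      qed
      then show ?thesis using insert.prems(2)[of \<tau> \<sigma>] that by auto
    qed
    have xb: "x \<in> boundary S F"
      using xS False insert.prems(2)[of x] by (auto simp: boundary_def strict_prefix_def)
    show ?thesis
    proof (cases "\<mu> = x")
      case True
      have "{z \<in> boundary S (insert x F). prefix \<mu> z} = children S x"
        unfolding eq True using boundary_parallel[OF xb]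
        by (auto simp: children_def)
      with ch True show ?thesis by simp
    next
      case mx: False
      then have mu: "\<mu> \<in> F" using insert.prems by auto
      have IH: "(\<phi> has_sum \<phi> \<mu>) {z \<in> boundary S F. prefix \<mu> z}"
      proof (rule insert.IH[OF _ _ mu])
        show "F \<subseteq> S" using insert.prems(1) by simp
        show "\<sigma> \<in> F" if "\<tau> \<in> F" "prefix \<sigma> \<tau>" for \<sigma> \<tau>
          using that by (rule closed)
      qed
      show ?thesis
      proof (cases "prefix \<mu> x")
        case True
        have disj: "(boundary S F - {x}) \<inter> children S x = {}"
          using boundary_parallel[OF xb] by (auto simp: children_def)
        have e1: "{z \<in> boundary S (insert x F). prefix \<mu> z} =
            {z \<in> boundary S F - {x}. prefix \<mu> z} \<union> children S x"
          unfolding eq using True by (auto simp: children_def intro: prefix_order.trans)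
        have "(\<phi> has_sum (\<phi> \<mu> - \<phi> x)) {z \<in> boundary S F - {x}. prefix \<mu> z}"
        proof -
          \<comment> \<open>Adding a family supported at \<open>x\<close> cancels the term there.
            The vanishing term can then be dropped from the index set.\<close>
          have "((\<lambda>z. if z = x then - \<phi> x else 0) has_sum - \<phi> x)
              {z \<in> boundary S F. prefix \<mu> z}"
            using xb True
            by (intro iffD1[OF has_sum_cong_neutral has_sum_finiteI[of "{x}" _ "\<lambda>_. - \<phi> x"]]) auto
          from has_sum_add[OF IH this]
          show ?thesis unfolding diff_conv_add_uminus
            by (rule iffD1[OF has_sum_cong_neutral, rotated -1]) auto
        qed
        from has_sum_Un_disjoint[OF this ch] disj show ?thesis
          unfolding e1 by auto
      next
        case False
        \<comment> \<open>A prefix of a child of \<open>x\<close> that is not a prefix of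
          \<open>x\<close> is the child itself, which is longer than every node of
          \<open>F\<close>.\<close>
        have "prefix \<mu> z \<Longrightarrow> z \<notin> children S x" for z
        proof
          assume p: "prefix \<mu> z" "z \<in> children S x"
          then obtain a where a: "z = x @ [a]"
            by (blast elim: childrenE)
          with p False have "\<mu> = x @ [a]" by (auto simp: prefix_snoc)
          with insert.hyps(2)[OF mu] show False by simp
        qed
        then have "{z \<in> boundary S (insert x F). prefix \<mu> z} = {z \<in> boundary S F. prefix \<mu> z}"
          unfolding eq using False by auto
        with IH show ?thesis by simp
      qed
    qed
  qed
qed

section \<open>Norms of linear combinations\<close>

lemma (in banach_over) bounded_linear_smul: "bounded_linear (smul c)"
proof (rule bounded_linear_intro)
  show "smul c (r *\<^sub>R x) = r *\<^sub>R smul c x" for r x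
    by (simp flip: smul_of_real add: mult.commute)
  show "norm (smul c x) \<le> norm x * norm c" for x by (simp add: norm_smul)
qed (rule scale_right_distrib)

text \<open>The separation property gives the identity for finite partial sums. It passes to the
  limit along finite subsets because the \<open>p\<close>-th power of the norm is continuous for
  \<open>p > 0\<close>.\<close>

lemma has_sum_separating:
  fixes \<phi> :: "nat list \<Rightarrow> 'b::banach" and smul :: "'k::real_or_complex \<Rightarrow> 'b \<Rightarrow> 'b"
  assumes p: "0 < p" and sep: "formally_separating p smul S \<phi>" and X: "X \<subseteq> S"
    and par: "\<And>x y. x \<in> X \<Longrightarrow> y \<in> X \<Longrightarrow> x \<noteq> y \<Longrightarrow> x \<parallel> y"
    and hs: "((\<lambda>x. smul (d x) (\<phi> x)) has_sum v) X"
  shows "((\<lambda>x. norm (d x) powr p * norm (\<phi> x) powr p) has_sum norm v powr p) X"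
proof -
  have fin: "(\<Sum>x\<in>A. norm (d x) powr p * norm (\<phi> x) powr p) =
      norm (\<Sum>x\<in>A. smul (d x) (\<phi> x)) powr p" if A: "finite A" "A \<subseteq> X" for A
  proof -
    obtain h n where h: "bij_betw h {..<n::nat} A"
      using ex_bij_betw_nat_finite[OF A(1)] by (auto simp: atLeast0LessThan)
    have hA: "h i \<in> A" if "i < n" for i using h that by (auto simp: bij_betw_def)
    have hi: "h i = h j \<longleftrightarrow> i = j" if "i < n" "j < n" for i j
      using h that by (auto simp: bij_betw_def inj_on_def)
    have "formally_disjointly_supported p smul n (\<lambda>i. \<phi> (h i))"
      using sep hA hi A(2) X par unfolding formally_separating_def
      by (metis subsetD)
    then have "norm (\<Sum>j<n. smul (d (h j)) (\<phi> (h j))) powr p =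
        (\<Sum>j<n. norm (d (h j)) powr p * norm (\<phi> (h j)) powr p)"
      by (auto simp: formally_disjointly_supported_def
          dest: spec[of _ "\<lambda>j. d (h j)"])
    then show ?thesis
      by (simp add: sum.reindex_bij_betw[OF h, of "\<lambda>x. norm (d x) powr p * norm (\<phi> x) powr p"]
          sum.reindex_bij_betw[OF h, of "\<lambda>x. smul (d x) (\<phi> x)"])
  qed
  have "((\<lambda>A. norm (\<Sum>x\<in>A. smul (d x) (\<phi> x)) powr p) \<longlongrightarrow> norm v powr p)
      (finite_subsets_at_top X)"
    using hs p unfolding has_sum_def by (intro tendsto_powr2 tendsto_norm) auto
  then show ?thesis unfolding has_sum_def
    by (rule Lim_transform_eventually)
      (auto simp: fin intro!: eventually_finite_subsets_at_top_weakI)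
qed

lemma has_sum_finite_sum:
  fixes g :: "'i \<Rightarrow> 'a \<Rightarrow> 'b::topological_comm_monoid_add"
  assumes "\<And>i. i \<in> F \<Longrightarrow> (g i has_sum s i) A"
  shows "((\<lambda>x. \<Sum>i\<in>F. g i x) has_sum (\<Sum>i\<in>F. s i)) A"
  using assms by (induction F rule: infinite_finite_induct) (auto intro: has_sum_add)

text \<open>The coefficient at a boundary node \<open>x\<close> collects the coefficients of all nodes of \<open>F\<close> below \<open>x\<close>.\<close>

lemma has_sum_norm_combination:
  fixes \<phi> :: "nat list \<Rightarrow> 'b::banach" and smul :: "'k::real_or_complex \<Rightarrow> 'b \<Rightarrow> 'b"
  assumes B: "banach_over smul" and p: "0 < p" and S: "is_tree S"
    and \<phi>: "formal_disintegration p smul S \<phi>"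
    and F: "finite F" "F \<subseteq> S"
    and closed: "\<And>\<sigma> \<tau>. \<tau> \<in> F \<Longrightarrow> prefix \<sigma> \<tau> \<Longrightarrow> \<sigma> \<in> F"
  shows "((\<lambda>x. norm (\<Sum>\<mu>\<in>F. if prefix \<mu> x then c \<mu> else 0) powr p * norm (\<phi> x) powr p)
    has_sum norm (\<Sum>\<mu>\<in>F. smul (c \<mu>) (\<phi> \<mu>)) powr p) (boundary S F)"
proof (rule has_sum_separating[OF p])
  interpret banach_over smul by fact
  show "formally_separating p smul S \<phi>" using \<phi> by (simp add: formal_disintegration_def)
  show "boundary S F \<subseteq> S" by (auto simp: boundary_def)
  show "x \<parallel> y" if "x \<in> boundary S F" "y \<in> boundary S F" "x \<noteq> y" for x y
    using that by (rule boundary_parallel)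
  \<comment> \<open>Extension by zero puts the expansions of all \<mu> on the common index set
    \<open>boundary S F\<close>, where they can be added.\<close>
  have "((\<lambda>x. if prefix \<mu> x then smul (c \<mu>) (\<phi> x) else 0) has_sum smul (c \<mu>) (\<phi> \<mu>))
      (boundary S F)" if "\<mu> \<in> F" for \<mu>
  proof -
    have "(\<phi> has_sum \<phi> \<mu>) {x \<in> boundary S F. prefix \<mu> x}"
      by (rule has_sum_boundary[OF S _ F _ that])
        (use \<phi> closed in \<open>auto simp: formal_disintegration_def\<close>)
    from has_sum_bounded_linear[OF bounded_linear_smul this]
    show ?thesis by (rule iffD1[OF has_sum_cong_neutral, rotated -1]) auto
  qed
  then have "((\<lambda>x. \<Sum>\<mu>\<in>F. if prefix \<mu> x then smul (c \<mu>) (\<phi> x) else 0)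
      has_sum (\<Sum>\<mu>\<in>F. smul (c \<mu>) (\<phi> \<mu>))) (boundary S F)"
    by (rule has_sum_finite_sum)
  then show "((\<lambda>x. smul (\<Sum>\<mu>\<in>F. if prefix \<mu> x then c \<mu> else 0) (\<phi> x))
      has_sum (\<Sum>\<mu>\<in>F. smul (c \<mu>) (\<phi> \<mu>))) (boundary S F)"
    by (simp add: scale_sum_left if_distrib[of "\<lambda>a. smul a _"] cong: if_cong)
qed

text \<open>After \<open>F\<close> is enlarged to a prefix-closed set, \<open>f\<close> carries this
  set and its boundary to their counterparts in \<open>S1\<close>. The two series that compute the
  \<open>p\<close>-th powers of the norms then agree term by term.\<close>

lemma disintegration_iso_norm_combination:
  fixes smul0 :: "'k::real_or_complex \<Rightarrow> 'b0::banach \<Rightarrow> 'b0"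
    and smul1 :: "'k \<Rightarrow> 'b1::banach \<Rightarrow> 'b1"
  assumes p: "0 < p"
    and B0: "banach_over smul0" and B1: "banach_over smul1"
    and S0: "is_tree S0" and S1: "is_tree S1"
    and \<phi>0: "formal_disintegration p smul0 S0 \<phi>0"
    and \<phi>1: "formal_disintegration p smul1 S1 \<phi>1"
    and f: "disintegration_iso S0 \<phi>0 S1 \<phi>1 f"
    and F: "finite F" "F \<subseteq> S0"
  shows "norm (\<Sum>\<nu>\<in>F. smul0 (c \<nu>) (\<phi>0 \<nu>)) = norm (\<Sum>\<nu>\<in>F. smul1 (c \<nu>) (\<phi>1 (f \<nu>)))"
proof -
  interpret B0: banach_over smul0 by fact
  interpret B1: banach_over smul1 by fact
  have bij: "bij_betw f S0 S1"
    and pre: "\<And>\<mu> \<nu>. \<mu> \<in> S0 \<Longrightarrow> \<nu> \<in> S0 \<Longrightarrow> prefix (f \<mu>) (f \<nu>) \<longleftrightarrow> prefix \<mu> \<nu>"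
    and nrm: "\<And>\<nu>. \<nu> \<in> S0 \<Longrightarrow> norm (\<phi>1 (f \<nu>)) = norm (\<phi>0 \<nu>)"
    using f by (auto simp: disintegration_iso_def)
  have inj: "inj_on f S0" and img: "f ` S0 = S1" using bij by (auto simp: bij_betw_def)
  \<comment> \<open>\<open>G\<close> is the prefix closure of \<open>F\<close>, finite because a
    list has finitely many prefixes. The new nodes receive coefficient 0 in \<open>d\<close>, so
    both linear combinations keep their values.\<close>
  define G where "G = (\<Union>\<tau>\<in>F. {\<sigma>. prefix \<sigma> \<tau>})"
  define d where "d \<nu> = (if \<nu> \<in> F then c \<nu> else 0)" for \<nu>
  have "{\<sigma>. prefix \<sigma> \<tau>} = set (prefixes \<tau>)" for \<tau> :: "nat list" by auto
  then have finG: "finite G" using F unfolding G_def by simp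
  have GS: "G \<subseteq> S0" using F S0 unfolding G_def is_tree_def by blast
  have Gcl: "\<sigma> \<in> G" if "\<tau> \<in> G" "prefix \<sigma> \<tau>" for \<sigma> \<tau>
    using that unfolding G_def by (auto intro: prefix_order.trans)
  have FG: "F \<subseteq> G" unfolding G_def by auto
  have injG: "inj_on f G" using inj GS inj_on_subset by blast
  \<comment> \<open>Since \<open>S1\<close> is a tree, \<sigma> has a preimage in \<open>S0\<close>.
    As \<open>f\<close> reflects prefixes, this preimage is a prefix of a node of
    \<open>G\<close>.\<close>
  have fGcl: "\<sigma> \<in> f ` G" if \<tau>: "\<tau> \<in> f ` G" and \<sigma>: "prefix \<sigma> \<tau>" for \<sigma> \<tau>
  proof -
    obtain t where t: "t \<in> G" "\<tau> = f t" using \<tau> by auto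
    then have "\<tau> \<in> S1" using GS img by auto
    then have "\<sigma> \<in> S1" using \<sigma> S1 unfolding is_tree_def by blast
    then obtain s where s: "s \<in> S0" "\<sigma> = f s" using img by auto
    have "prefix s t" using pre[OF s(1), of t] t s \<sigma> GS by auto
    then show ?thesis using Gcl t(1) s(2) by blast
  qed
  have bnd: "boundary S1 (f ` G) = f ` boundary S0 G"
  proof -
    have mem: "f z \<in> f ` G \<longleftrightarrow> z \<in> G" if "z \<in> S0" for z
      using that GS inj by (auto simp: inj_on_image_mem_iff)
    have sp: "strict_prefix (f y) (f x) \<longleftrightarrow> strict_prefix y x" if "y \<in> S0" "x \<in> S0" for x y
      using that pre inj by (auto simp: strict_prefix_def inj_on_eq_iff)
    have "boundary S1 (f ` G) = f ` {x \<in> S0. f x \<notin> f ` G \<and>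
        (\<forall>y\<in>S0. strict_prefix (f y) (f x) \<longrightarrow> f y \<in> f ` G)}"
      unfolding boundary_def img[symmetric] by (auto simp: image_iff)
    also have "\<dots> = f ` boundary S0 G"
      unfolding boundary_def using mem sp by (intro arg_cong[of _ _ "(`) f"]) auto
    finally show ?thesis .
  qed
  have bS: "boundary S0 G \<subseteq> S0" by (auto simp: boundary_def)
  \<comment> \<open>On the side of \<open>S1\<close> the coefficients must be indexed by nodes of
    \<open>S1\<close>, so \<open>d\<close> is transported along the inverse of
    \<open>f\<close>.\<close>
  define g where "g = inv_into S0 f"
  have gf: "g (f x) = x" if "x \<in> S0" for x using inj that by (simp add: g_def)
  have 0: "((\<lambda>x. norm (\<Sum>\<mu>\<in>G. if prefix \<mu> x then d \<mu> else 0) powr p * norm (\<phi>0 x) powr p)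
    has_sum norm (\<Sum>\<mu>\<in>G. smul0 (d \<mu>) (\<phi>0 \<mu>)) powr p) (boundary S0 G)"
    by (rule has_sum_norm_combination[OF B0 p S0 \<phi>0 finG GS Gcl])
  have "f ` G \<subseteq> S1" using GS img by auto
  then have "((\<lambda>x. norm (\<Sum>\<mu>\<in>f ` G. if prefix \<mu> x then d (g \<mu>) else 0) powr p * norm (\<phi>1 x) powr p)
    has_sum norm (\<Sum>\<mu>\<in>f ` G. smul1 (d (g \<mu>)) (\<phi>1 \<mu>)) powr p) (f ` boundary S0 G)"
    unfolding bnd[symmetric] using fGcl
    by (rule has_sum_norm_combination[OF B1 p S1 \<phi>1 finite_imageI[OF finG]])
  then have 1: "((\<lambda>x. norm (\<Sum>\<mu>\<in>G. if prefix (f \<mu>) (f x) then d (g (f \<mu>)) else 0) powr p *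
      norm (\<phi>1 (f x)) powr p)
    has_sum norm (\<Sum>\<mu>\<in>G. smul1 (d (g (f \<mu>))) (\<phi>1 (f \<mu>))) powr p) (boundary S0 G)"
    by (simp add: has_sum_reindex[OF inj_on_subset[OF inj bS]] sum.reindex[OF injG] o_def)
  have s1: "(\<Sum>\<mu>\<in>G. smul1 (d (g (f \<mu>))) (\<phi>1 (f \<mu>))) = (\<Sum>\<mu>\<in>G. smul1 (d \<mu>) (\<phi>1 (f \<mu>)))"
    using GS gf by (intro sum.cong) auto
  have "((\<lambda>x. norm (\<Sum>\<mu>\<in>G. if prefix \<mu> x then d \<mu> else 0) powr p * norm (\<phi>0 x) powr p)
    has_sum norm (\<Sum>\<mu>\<in>G. smul1 (d \<mu>) (\<phi>1 (f \<mu>))) powr p) (boundary S0 G)"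
  proof (rule iffD1[OF has_sum_cong 1[unfolded s1]])
    fix x assume "x \<in> boundary S0 G"
    then have x: "x \<in> S0" using bS by auto
    have "(\<Sum>\<mu>\<in>G. if prefix (f \<mu>) (f x) then d (g (f \<mu>)) else 0) =
        (\<Sum>\<mu>\<in>G. if prefix \<mu> x then d \<mu> else 0)"
      using GS gf pre x by (intro sum.cong) auto
    then show "norm (\<Sum>\<mu>\<in>G. if prefix (f \<mu>) (f x) then d (g (f \<mu>)) else 0) powr p *
        norm (\<phi>1 (f x)) powr p =
      norm (\<Sum>\<mu>\<in>G. if prefix \<mu> x then d \<mu> else 0) powr p * norm (\<phi>0 x) powr p"
      using nrm x by simp
  qed
  from has_sum_unique[OF 0 this]
  \<comment> \<open>Equal \<open>p\<close>-th powers give equal norms, as \<open>powr p\<close> is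
    strictly increasing on nonnegative reals.\<close>
  have "norm (\<Sum>\<mu>\<in>G. smul0 (d \<mu>) (\<phi>0 \<mu>)) = norm (\<Sum>\<mu>\<in>G. smul1 (d \<mu>) (\<phi>1 (f \<mu>)))"
    using p powr_less_mono2[OF p norm_ge_zero] by (metis less_irrefl linorder_less_linear)
  moreover have "(\<Sum>\<mu>\<in>G. smul0 (d \<mu>) (\<phi>0 \<mu>)) = (\<Sum>\<nu>\<in>F. smul0 (c \<nu>) (\<phi>0 \<nu>))"
    using FG finG by (intro sum.mono_neutral_cong_right) (auto simp: d_def)
  moreover have "(\<Sum>\<mu>\<in>G. smul1 (d \<mu>) (\<phi>1 (f \<mu>))) = (\<Sum>\<nu>\<in>F. smul1 (c \<nu>) (\<phi>1 (f \<nu>)))"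
    using FG finG by (intro sum.mono_neutral_cong_right) (auto simp: d_def)
  ultimately show ?thesis by simp
qed

section \<open>From equal norms to an isometry: closing the graph\<close>

lemma subspace_closure:
  fixes G :: "'a::real_normed_vector set"
  assumes "subspace G"
  shows "subspace (closure G)"
proof (rule subspaceI)
  show "0 \<in> closure G" using assms closure_subset subspace_0 by blast
  show "x + y \<in> closure G" if xy: "x \<in> closure G" "y \<in> closure G" for x y
  proof -
    obtain a b where "\<And>n::nat. a n \<in> G" "a \<longlonglongrightarrow> x" "\<And>n::nat. b n \<in> G" "b \<longlonglongrightarrow> y"
      using xy unfolding closure_sequential by blast
    then have "(\<lambda>n. a n + b n) \<longlonglongrightarrow> x + y" "\<And>n. a n + b n \<in> G"
      using assms by (auto intro: tendsto_add subspace_add)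
    then show ?thesis unfolding closure_sequential
      by (intro exI[of _ "\<lambda>n. a n + b n"]) auto
  qed
  show "c *\<^sub>R x \<in> closure G" if "x \<in> closure G" for c x
  proof -
    have "c *\<^sub>R x \<in> (*\<^sub>R) c ` closure G" using that by (rule imageI)
    also have "\<dots> \<subseteq> closure ((*\<^sub>R) c ` G)"
      by (rule closure_bounded_linear_image_subset[OF bounded_linear_scaleR_right])
    also have "\<dots> \<subseteq> closure G"
      using assms by (intro closure_mono) (auto intro: subspace_scale)
    finally show ?thesis .
  qed
qed

text \<open>The lower bound makes the image of the complete subspace \<open>closure G\<close>
  complete, hence closed, and this image contains a dense set. The lemma serves both coordinate
  projections of the closed graph.\<close>

lemma bounded_below_image_closure_eq_UNIV:
  fixes h :: "'a::banach \<Rightarrow> 'b::banach"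
  assumes h: "bounded_linear h" and e: "e > 0" and K: "subspace (closure G)"
    and bound: "\<And>z. z \<in> closure G \<Longrightarrow> e * norm z \<le> norm (h z)"
    and dense: "closure (h ` G) = UNIV"
  shows "h ` closure G = UNIV"
proof -
  have "complete (h ` closure G)"
    by (rule complete_isometric_image[OF e K h]) (use bound in \<open>auto simp: complete_eq_closed\<close>)
  then have "closed (h ` closure G)" by (rule complete_imp_closed)
  then have "closure (h ` G) \<subseteq> h ` closure G"
    by (intro closure_minimal image_mono closure_subset)
  with dense show ?thesis by auto
qed

text \<open>Agreement spreads from \<open>A\<close> to its span by linearity. Isometries are
  continuous, so the set of agreement is closed and contains the closure of the span.\<close>

lemma isometric_isomorphism_unique:
  fixes smul0 :: "'k::real_or_complex \<Rightarrow> 'b0::banach \<Rightarrow> 'b0"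
    and smul1 :: "'k \<Rightarrow> 'b1::banach \<Rightarrow> 'b1"
  assumes B0: "banach_over smul0"
    and T: "isometric_isomorphism smul0 smul1 T" and T': "isometric_isomorphism smul0 smul1 T'"
    and dense: "closure (module.span smul0 A) = UNIV"
    and eq: "\<And>x. x \<in> A \<Longrightarrow> T x = T' x"
  shows "T = T'"
proof
  interpret B0: banach_over smul0 by fact
  have cont: "continuous_on UNIV R" if R: "isometric_isomorphism smul0 smul1 R" for R
  proof -
    interpret R: Vector_Spaces.linear smul0 smul1 R
      using R by (simp add: isometric_isomorphism_def)
    have "dist (R x) (R y) = dist x y" for x y
      using R by (simp add: dist_norm isometric_isomorphism_def flip: R.diff)
    then show ?thesis by (auto simp: continuous_on_iff)
  qed
  interpret p: vector_space_pair smul0 smul1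
    using T by (simp add: isometric_isomorphism_def Vector_Spaces.linear_def vector_space_pair_def)
  have "T x = T' x" if "x \<in> B0.span A" for x
    using T T' eq that by (auto simp: isometric_isomorphism_def intro: p.linear_eq_on)
  then have "B0.span A \<subseteq> {x. T x = T' x}" by auto
  moreover have "closed {x. T x = T' x}"
    using cont[OF T] cont[OF T'] by (rule closed_Collect_eq)
  ultimately have "closure (B0.span A) \<subseteq> {x. T x = T' x}" by (rule closure_minimal)
  with dense show "T x = T' x" for x by auto
qed

text \<open>Both components of a point in the closed span of the pairs \<open>(u i, w i)\<close>
  have the same norm. Hence this space is the graph of an injective isometry, and density of the two
  spans makes its domain and its range everything.\<close>

lemma isometric_isomorphism_exists:
  fixes smul0 :: "'k::real_or_complex \<Rightarrow> 'b0::banach \<Rightarrow> 'b0"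
    and smul1 :: "'k \<Rightarrow> 'b1::banach \<Rightarrow> 'b1"
    and u :: "'i \<Rightarrow> 'b0" and w :: "'i \<Rightarrow> 'b1"
  assumes B0: "banach_over smul0" and B1: "banach_over smul1"
    and dense0: "closure (module.span smul0 (u ` I)) = UNIV"
    and dense1: "closure (module.span smul1 (w ` I)) = UNIV"
    and norm_eq: "\<And>F c. finite F \<Longrightarrow> F \<subseteq> I \<Longrightarrow>
      norm (\<Sum>i\<in>F. smul0 (c i) (u i)) = norm (\<Sum>i\<in>F. smul1 (c i) (w i))"
  shows "\<exists>T. isometric_isomorphism smul0 smul1 T \<and> (\<forall>i\<in>I. T (u i) = w i)"
proof -
  interpret B0: banach_over smul0 by fact
  interpret B1: banach_over smul1 by fact
  \<comment> \<open>Componentwise multiplication by field scalars. It extends the real scaling of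
    the product space, so \<open>P.span\<close> yields a real subspace as well.\<close>
  define sm where "sm c z = (smul0 c (fst z), smul1 c (snd z))" for c z
  interpret P: vector_space sm
    by unfold_locales (auto simp: sm_def B0.scale_right_distrib B1.scale_right_distrib
        B0.scale_left_distrib B1.scale_left_distrib)
  interpret f: Vector_Spaces.linear sm smul0 fst
    by unfold_locales (auto simp: sm_def)
  interpret s: Vector_Spaces.linear sm smul1 snd
    by unfold_locales (auto simp: sm_def)
  define g where "g i = (u i, w i)" for i
  define G where "G = P.span (g ` I)"
  have norm_G: "norm (fst z) = norm (snd z)" if "z \<in> G" for z
  proof -
    have "\<exists>t r. z = (\<Sum>a\<in>t. sm (r a) a) \<and> finite t \<and> t \<subseteq> g ` I"
      using that by (simp add: G_def P.span_explicit)
    then obtain t r where t: "finite t" "t \<subseteq> g ` I" and z: "z = (\<Sum>a\<in>t. sm (r a) a)"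
      by metis
    \<comment> \<open>Different indices may give the same pair, so \<open>F\<close> picks one index
      for each pair that occurs.\<close>
    then obtain F where F: "F \<subseteq> I" "inj_on g F" "t = g ` F" by (auto simp: subset_image_inj)
    then have "finite F" using t finite_imageD by blast
    moreover have "z = (\<Sum>i\<in>F. sm (r (g i)) (g i))" using z F by (simp add: sum.reindex)
    ultimately show ?thesis using norm_eq[of F "\<lambda>i. r (g i)"] F
      by (simp add: fst_sum snd_sum sm_def g_def)
  qed
  have "closed {z :: 'b0 \<times> 'b1. norm (fst z) = norm (snd z)}"
    by (intro closed_Collect_eq continuous_intros)
  then have "closure G \<subseteq> {z. norm (fst z) = norm (snd z)}"
    using norm_G by (intro closure_minimal) auto
  then have norm_K: "norm (fst z) = norm (snd z)" if "z \<in> closure G" for z using that by auto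
  have sm_real: "sm (of_real r) z = r *\<^sub>R z" for r z
    by (simp add: sm_def B0.smul_of_real B1.smul_of_real prod_eq_iff)
  have "subspace G"
    using P.subspace_span[of "g ` I"] unfolding subspace_def P.subspace_def G_def
    by (metis sm_real)
  then have K: "subspace (closure G)" by (rule subspace_closure)
  have bl: "bounded_linear (sm c)" for c
    unfolding sm_def by (intro bounded_linear_Pair bounded_linear_compose[OF B0.bounded_linear_smul]
        bounded_linear_compose[OF B1.bounded_linear_smul] bounded_linear_fst bounded_linear_snd)
  have sm_K: "sm c z \<in> closure G" if "z \<in> closure G" for c z
  proof -
    have "sm c ` closure G \<subseteq> closure (sm c ` G)"
      by (rule closure_bounded_linear_image_subset[OF bl])
    also have "\<dots> \<subseteq> closure G"
      unfolding G_def by (intro closure_mono) (auto intro: P.span_scale)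
    finally show ?thesis using that by auto
  qed
  \<comment> \<open>The norm of a pair is at most the sum of the norms of its components, which are
    equal here; this gives the factor 1/2.\<close>
  have "1/2 * norm z \<le> norm (fst z)" "1/2 * norm z \<le> norm (snd z)" if "z \<in> closure G" for z
    using norm_K[OF that] norm_Pair_le[of "fst z" "snd z"] by auto
  moreover have "fst ` G = B0.span (u ` I)" "snd ` G = B1.span (w ` I)"
    unfolding G_def by (simp_all add: image_image g_def flip: f.span_image s.span_image)
  ultimately have fst_K: "fst ` closure G = UNIV" and snd_K: "snd ` closure G = UNIV"
    using dense0 dense1 K
      bounded_below_image_closure_eq_UNIV[OF bounded_linear_fst, of "1/2" G]
      bounded_below_image_closure_eq_UNIV[OF bounded_linear_snd, of "1/2" G]
    by auto
  \<comment> \<open>The two components of the difference of two points have equal norm, so they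
    vanish together. One direction makes \<open>T\<close> well defined, the other makes it
    injective.\<close>
  have fun0: "x = y \<longleftrightarrow> x' = y'"
    if "(x, x') \<in> closure G" "(y, y') \<in> closure G" for x y x' y'
    using norm_K[OF subspace_diff[OF K that]] by auto
  define T where "T x = (THE y. (x, y) \<in> closure G)" for x
  have T_eq: "T x = y" if "(x, y) \<in> closure G" for x y
    unfolding T_def using that fun0 by blast
  have T: "(x, T x) \<in> closure G" for x
  proof -
    obtain z where "z \<in> closure G" "x = fst z" using fst_K by blast
    then have "(x, snd z) \<in> closure G" by simp
    with T_eq show ?thesis by metis
  qed
  \<comment> \<open>Linearity holds because the graph is closed under addition and under
    \<open>sm\<close>.\<close>
  have "Vector_Spaces.linear smul0 smul1 T"
  proof unfold_locales
    show "T (x + y) = T x + T y" for x y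
      using subspace_add[OF K T[of x] T[of y]] by (intro T_eq) simp
    show "T (smul0 c x) = smul1 c (T x)" for c x
      using sm_K[OF T[of x], of c] by (intro T_eq) (simp add: sm_def)
  qed
  moreover have "bij T"
  proof (rule bijI)
    show "inj T" using T fun0 by (metis injI)
    show "surj T"
      unfolding surj_def
    proof
      fix y
      obtain z where "z \<in> closure G" "y = snd z" using snd_K by blast
      then have "T (fst z) = y" by (intro T_eq) simp
      then show "\<exists>x. y = T x" by metis
    qed
  qed
  moreover have "norm (T x) = norm x" for x using norm_K[OF T[of x]] by simp
  moreover have "T (u i) = w i" if "i \<in> I" for i
  proof (rule T_eq)
    have "g i \<in> G" unfolding G_def using that by (intro P.span_base) auto
    then show "(u i, w i) \<in> closure G" using closure_subset by (auto simp: g_def)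
  qed
  ultimately show ?thesis by (auto simp: isometric_isomorphism_def)
qed

theorem theorem2p7:
  fixes p :: real
    and smul0 :: "'k::real_or_complex \<Rightarrow> 'b0::banach \<Rightarrow> 'b0"
    and smul1 :: "'k \<Rightarrow> 'b1::banach \<Rightarrow> 'b1"
    and S0 S1 :: "nat list set"
    and \<phi>0 :: "nat list \<Rightarrow> 'b0" and \<phi>1 :: "nat list \<Rightarrow> 'b1"
    and f :: "nat list \<Rightarrow> nat list"
  assumes "1 \<le> p"
    and "banach_over smul0" and "banach_over smul1"
    and "is_tree S0" and "is_tree S1"
    and "formal_disintegration p smul0 S0 \<phi>0"
    and "formal_disintegration p smul1 S1 \<phi>1"
    and "disintegration_iso S0 \<phi>0 S1 \<phi>1 f"
  shows "\<exists>!T. isometric_isomorphism smul0 smul1 T \<and> (\<forall>\<nu>\<in>S0. T (\<phi>0 \<nu>) = \<phi>1 (f \<nu>))"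
proof -
  \<comment> \<open>Surjectivity of \<open>f\<close> onto \<open>S1\<close> turns density for
    \<phi>1 into density for the reindexed family.\<close>
  have img: "(\<lambda>\<nu>. \<phi>1 (f \<nu>)) ` S0 = \<phi>1 ` S1"
    using assms(8) by (auto simp: disintegration_iso_def bij_betw_def image_image[symmetric])
  have dense: "closure (module.span smul0 (\<phi>0 ` S0)) = UNIV"
      "closure (module.span smul1 ((\<lambda>\<nu>. \<phi>1 (f \<nu>)) ` S0)) = UNIV"
    unfolding img using assms(6,7) by (auto simp: formal_disintegration_def)
  have p: "0 < p" using assms(1) by simp
  have "\<exists>T. isometric_isomorphism smul0 smul1 T \<and> (\<forall>\<nu>\<in>S0. T (\<phi>0 \<nu>) = \<phi>1 (f \<nu>))"
    by (rule isometric_isomorphism_exists[OF assms(2,3) dense])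
      (rule disintegration_iso_norm_combination[OF p assms(2-8)])
  moreover have "T = T'"
    if "isometric_isomorphism smul0 smul1 T \<and> (\<forall>\<nu>\<in>S0. T (\<phi>0 \<nu>) = \<phi>1 (f \<nu>))"
      "isometric_isomorphism smul0 smul1 T' \<and> (\<forall>\<nu>\<in>S0. T' (\<phi>0 \<nu>) = \<phi>1 (f \<nu>))" for T T'
    using that by (intro isometric_isomorphism_unique[OF assms(2) _ _ dense(1)]) auto
  ultimately show ?thesis by blast
qed

end
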